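(* Let $k$ be a positive integer and let $p$ be an odd positive integer such that $p \nmid \big((2k-1)!!\big)^2$. Then $$2k\,\big((2k-1)!!\big)^2\left[\left(\tfrac{p-1}{2}\right)!\right]^2 + (-1)^{\frac{p-1}{2}}\Big[\big((2k-1)!!\big)^2(p+2k) + 4^k(-1)^{k+1}p\Big] \equiv 0 \pmod{p(p+2k)}$$ if and only if $p$ and $p+2k$ are both primes.
   Context: For a positive integer $n$, $(2n-1)!!$ denotes $\prod_{i=1}^{n}(2i-1)$. *)

theory Defs
  imports "HOL-Number_Theory.Number_Theory"
begin

definition odd_double_fact :: "nat \<Rightarrow> nat" where
  "odd_double_fact n = (\<Prod>i=1..n. 2 * i - 1)" (* value (2n-1)!!, indexed by n *)

end

theory Submission
  imports Defs
begin

text \<open>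
  Write \<open>p = 2m + 1\<close>, \<open>q = p + 2k\<close>, \<open>D = ((2k-1)!!)\<^sup>2\<close>. The left-hand side is
  \<open>2kD (m!\<^sup>2 + (-1)\<^sup>m)\<close> modulo \<open>p\<close>, and \<open>-p (D m!\<^sup>2 + (-1)\<^sup>m (-4)\<^sup>k)\<close> modulo \<open>q\<close>,
  where \<open>D m!\<^sup>2 \<equiv> 4\<^sup>k (m+k)!\<^sup>2\<close>. If \<open>p\<close> and \<open>q\<close> are prime, both vanish by Wilson's theorem.
  Conversely, every prime factor of an odd composite \<open>2n + 1\<close> divides \<open>n!\<close>. So if \<open>q\<close> were
  composite, the second bracket would be a unit modulo \<open>q\<close>, whence \<open>q\<close> would divide \<open>p < q\<close>.
  If \<open>q\<close> is prime and \<open>p\<close> composite, the first bracket is a unit modulo \<open>p\<close>, whence \<open>p\<close>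
  divides \<open>2kD\<close>; but \<open>p\<close> is coprime to \<open>2k = q - p\<close>, so \<open>p\<close> divides \<open>D\<close>.
\<close>

lemma odd_double_fact_Suc: "odd_double_fact (Suc k) = odd_double_fact k * (2 * k + 1)"
  by (simp add: odd_double_fact_def)

text \<open>Each of the top \<open>b\<close> factors of the left-hand factorial is minus one of
  \<open>1..b\<close> modulo \<open>a + b + 1\<close>. With \<open>a = b\<close>, this turns
  Wilson's theorem into a statement about a squared factorial.\<close>

lemma cong_fact_add:
  "[fact (a + b) = (-1) ^ b * fact a * fact b] (mod (int (a + b) + 1))"
proof (induction b arbitrary: a)
  case (Suc b)
  have "[(-1) ^ b * fact b * fact a * (int a + 1) = (-1) ^ b * fact b * fact a * (- (int b + 1))]
      (mod (int (a + Suc b) + 1))"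
    by (intro cong_scalar_left) (simp add: cong_iff_dvd_diff algebra_simps)
  then show ?case
    using Suc[of "Suc a"] by (auto simp: algebra_simps elim: cong_trans)
qed simp

text \<open>Doubling the top \<open>k\<close> factors gives \<open>2 * (m + j)\<close>, which is
  \<open>- (2 * (k - j) + 1)\<close> modulo \<open>2 * (m + k) + 1\<close>; these are the negatives
  of the first \<open>k\<close> odd numbers.\<close>

lemma cong_fact_odd_double_fact:
  "[2 ^ k * fact (m + k) = (-1) ^ k * int (odd_double_fact k) * fact m]
    (mod (2 * int (m + k) + 1))"
proof (induction k arbitrary: m)
  case 0
  then show ?case by (simp add: odd_double_fact_def)
next
  case (Suc k)
  let ?c = "(-1) ^ k * int (odd_double_fact k) * fact m" and ?q = "2 * int (m + Suc k) + 1"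
  \<comment> \<open>The induction hypothesis at \<open>Suc m\<close> has the same modulus, since
    \<open>Suc m + k = m + Suc k\<close>.\<close>
  have "[2 * (2 ^ k * fact (m + Suc k)) = 2 * ((-1) ^ k * int (odd_double_fact k) * fact (Suc m))]
      (mod ?q)"
    using Suc[of "Suc m"] by (intro cong_scalar_left) simp
  also have "2 * ((-1) ^ k * int (odd_double_fact k) * fact (Suc m)) = ?c * (2 * int m + 2)"
    by (simp add: algebra_simps)
  also have "[?c * (2 * int m + 2) = ?c * (- (2 * int k + 1))] (mod ?q)"
    by (intro cong_scalar_left) (simp add: cong_iff_dvd_diff algebra_simps)
  finally show ?case
    by (simp add: odd_double_fact_Suc algebra_simps)
qed

lemma cong_fact_half_square:
  assumes "prime (2 * n + 1)"
  shows "[(fact n)\<^sup>2 = - ((-1) ^ n)] (mod (2 * int n + 1))"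
proof -
  have "[fact (2 * n) = -1] (mod (2 * int n + 1))"
    using wilson_theorem[OF assms] by (simp add: algebra_simps)
  moreover have "[fact (2 * n) = (-1) ^ n * (fact n)\<^sup>2] (mod (2 * int n + 1))"
    using cong_fact_add[of n n] by (simp add: power2_eq_square mult.assoc flip: mult_2)
  ultimately have "[(-1) ^ n * (fact n)\<^sup>2 = -1] (mod (2 * int n + 1))"
    using cong_sym cong_trans by blast
  then have "[(-1) ^ n * ((-1) ^ n * (fact n)\<^sup>2) = (-1) ^ n * - 1] (mod (2 * int n + 1))"
    by (rule cong_scalar_left)
  then show ?thesis
    by (simp flip: mult.assoc power_add mult_2)
qed

text \<open>The cofactor of \<open>r\<close> is odd and not 1, hence at least 3, so \<open>r\<close>
  is at most a third of \<open>2 * n + 1\<close>.\<close>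

lemma prime_factor_dvd_fact_half:
  fixes r n :: nat
  assumes "prime r" "r dvd 2 * n + 1" "\<not> prime (2 * n + 1)"
  shows "r dvd fact n"
proof -
  obtain s where s: "2 * n + 1 = r * s" using assms(2) by blast
  have "s \<noteq> 1" using s assms by auto
  moreover have "odd (r * s)" unfolding s[symmetric] by simp
  ultimately have "s \<ge> 3" by simp presburger
  then have "r * 3 \<le> 2 * n + 1" using s by simp
  moreover have "r \<ge> 2" using assms(1) by (rule prime_ge_2_nat)
  ultimately have "r \<le> n" by linarith
  then show ?thesis using prime_dvd_fact_iff[OF assms(1)] by simp
qed

text \<open>A common prime factor of \<open>2 * n + 1\<close> and \<open>x + u\<close> divides
  \<open>fact n\<close>, hence \<open>x\<close>, hence the unit \<open>u\<close>.\<close>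

lemma coprime_add_unit_if_not_prime:
  fixes x u :: int
  assumes "\<not> prime (2 * n + 1)"
    and x: "\<And>r. prime r \<Longrightarrow> r dvd 2 * int n + 1 \<Longrightarrow> r dvd fact n \<Longrightarrow> r dvd x"
    and u: "coprime (2 * int n + 1) u"
  shows "coprime (2 * int n + 1) (x + u)"
proof (rule ccontr)
  assume "\<not> coprime (2 * int n + 1) (x + u)"
  then have "\<not> is_unit (gcd (2 * int n + 1) (x + u))" "gcd (2 * int n + 1) (x + u) \<noteq> 0"
    by (auto simp: coprime_iff_gcd_eq_1)
  then obtain r where r: "prime r" "r dvd gcd (2 * int n + 1) (x + u)"
    using prime_divisor_exists by blast
  obtain r' where r': "r = int r'" "prime r'"
    using r(1) by (metis prime_int_nat_transfer prime_ge_0_int nat_0_le)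
  have rq: "r dvd 2 * int n + 1" and rx: "r dvd x + u" using r(2) by auto
  have "r' dvd 2 * n + 1"
    using rq unfolding r'(1) by (simp add: algebra_simps flip: int_dvd_int_iff)
  then have "r' dvd fact n" using prime_factor_dvd_fact_half r'(2) assms(1) by blast
  then have "r dvd fact n" unfolding r'(1) by (metis int_dvd_int_iff of_nat_fact)
  then have "r dvd x" using x r(1) rq by blast
  then have "r dvd u" using rx by (simp add: dvd_add_right_iff)
  then show False using u rq r(1) by (meson coprime_common_divisor not_prime_unit)
qed

theorem theorem7:
  fixes k p :: nat
  assumes "k > 0" and "odd p" and "\<not> p dvd (odd_double_fact k)\<^sup>2"
  shows "[2 * int k * (int (odd_double_fact k))\<^sup>2 * (fact ((p - 1) div 2))\<^sup>2
           + (-1) ^ ((p - 1) div 2)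
             * ((int (odd_double_fact k))\<^sup>2 * (int p + 2 * int k)
                + 4 ^ k * (-1) ^ (k + 1) * int p) = 0]
           (mod (int p * (int p + 2 * int k)))
         \<longleftrightarrow> prime p \<and> prime (p + 2 * k)"
proof -
  obtain m where m: "p = 2 * m + 1" using assms(2) by (elim oddE)
  then have pm: "(p - 1) div 2 = m" and q: "p + 2 * k = 2 * (m + k) + 1" by simp_all
  define P Q D F s where "P = int p" and "Q = P + 2 * int k" and "D = (int (odd_double_fact k))\<^sup>2"
    and "F = (fact m :: int)\<^sup>2" and "s = (-1 :: int) ^ m"
  define E where "E = 2 * int k * D * F + s * (D * Q + 4 ^ k * (-1) ^ (k + 1) * P)"
  have P: "P = 2 * int m + 1" and Q: "Q = 2 * int (m + k) + 1" and Qp: "Q = int (p + 2 * k)"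
    by (simp_all add: P_def Q_def m)
  have neg4: "4 ^ k * (-1) ^ (k + 1) = - ((-4 :: int) ^ k)"
    by (simp flip: power_mult_distrib)
  have EP: "E = 2 * int k * D * (F + s) + P * (s * D - s * (-4) ^ k)"
    unfolding E_def neg4 Q_def by (simp add: algebra_simps)
  \<comment> \<open>Here \<open>2 * int k\<close> is rewritten as \<open>Q - P\<close>.\<close>
  have EQ: "E = - P * (D * F + s * (-4) ^ k) + Q * (D * F + s * D)"
    unfolding E_def neg4 Q_def by (simp add: algebra_simps)
  have P_dvd_E: "P dvd E \<longleftrightarrow> P dvd 2 * int k * D * (F + s)"
    unfolding EP by (simp add: dvd_add_left_iff)
  have Q_dvd_E: "Q dvd E \<longleftrightarrow> Q dvd P * (D * F + s * (-4) ^ k)"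
    unfolding EQ by (simp add: dvd_diff_right_iff)
  have DF: "[4 ^ k * (fact (m + k))\<^sup>2 = D * F] (mod Q)"
  proof -
    have "[(2 ^ k * fact (m + k))\<^sup>2 = ((-1) ^ k * int (odd_double_fact k) * fact m)\<^sup>2] (mod Q)"
      using cong_fact_odd_double_fact[of k m] unfolding Q by (rule cong_pow)
    moreover have "((2::int) ^ k)\<^sup>2 = 4 ^ k" "((-1 :: int) ^ k)\<^sup>2 = 1"
      by (simp_all add: power2_eq_square flip: power_mult_distrib)
    ultimately show ?thesis
      by (simp add: power_mult_distrib D_def F_def)
  qed
  have "P * Q dvd E \<longleftrightarrow> prime p \<and> prime (p + 2 * k)"
  proof
    assume "prime p \<and> prime (p + 2 * k)"
    then have pp: "prime p" and pq: "prime (p + 2 * k)" by auto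
    have "P dvd F + s"
      using cong_fact_half_square[of m] pp m
      by (simp add: cong_iff_dvd_diff P F_def s_def)
    then have 1: "P dvd E" unfolding P_dvd_E by simp
    have "[(fact (m + k))\<^sup>2 = - ((-1) ^ (m + k))] (mod Q)"
      using cong_fact_half_square[of "m + k"] pq unfolding q Q by simp
    then have "[4 ^ k * (fact (m + k))\<^sup>2 = 4 ^ k * - ((-1) ^ (m + k))] (mod Q)"
      by (rule cong_scalar_left)
    also have "4 ^ k * - ((-1) ^ (m + k)) = - (s * (-4) ^ k)"
      unfolding s_def using neg4 by (simp add: power_add)
    finally have "[D * F = - (s * (-4) ^ k)] (mod Q)"
      using DF cong_sym cong_trans by blast
    then have "Q dvd D * F + s * (-4) ^ k" by (simp add: cong_iff_dvd_diff)
    then have 2: "Q dvd E" unfolding Q_dvd_E by simp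
    have "coprime P Q"
      unfolding Qp P_def coprime_int_iff using primes_coprime[OF pp pq] assms(1) by simp
    with 1 2 show "P * Q dvd E" by (rule divides_mult)
  next
    assume "P * Q dvd E"
    then have Pd: "P dvd 2 * int k * D * (F + s)" and Qd: "Q dvd P * (D * F + s * (-4) ^ k)"
      using P_dvd_E Q_dvd_E dvd_mult_left dvd_mult_right by blast+
    \<comment> \<open>\<open>0 < P < Q\<close> because \<open>k > 0\<close>.\<close>
    have PQ: "\<not> Q dvd P" using zdvd_not_zless[of P Q] assms(1) by (simp add: P Q)
    have pq: "prime (p + 2 * k)"
    proof (rule ccontr)
      assume "\<not> prime (p + 2 * k)"
      then have "coprime Q (D * F + s * (-4) ^ k)"
        unfolding q Q
      proof (rule coprime_add_unit_if_not_prime)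
        fix r :: int
        assume "prime r" "r dvd 2 * int (m + k) + 1" "r dvd fact (m + k)"
        moreover from this have "r dvd 4 ^ k * (fact (m + k))\<^sup>2"
          by (simp add: power2_eq_square)
        \<comment> \<open>\<open>DF\<close> holds modulo \<open>Q\<close>, hence also modulo its
          divisor \<open>r\<close>.\<close>
        ultimately show "r dvd D * F"
          using DF unfolding Q by (meson cong_dvd_iff cong_dvd_modulus)
      next
        have "coprime (2 * int (m + k) + 1) 2" by simp
        then have "coprime (2 * int (m + k) + 1) (2 * 2)" by (simp only: coprime_mult_right_iff)
        then show "coprime (2 * int (m + k) + 1) (s * (-4) ^ k)"
          by (simp add: s_def)
      qed
      then show False using Qd PQ by (simp add: coprime_dvd_mult_left_iff)
    qed
    have "prime p"
    proof (rule ccontr)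
      assume "\<not> prime p"
      then have "coprime P (F + s)"
        unfolding m P
        by (rule coprime_add_unit_if_not_prime) (auto simp: F_def s_def power2_eq_square)
      then have "P dvd 2 * int k * D" using Pd by (simp add: coprime_dvd_mult_left_iff)
      moreover have "coprime P (2 * int k)"
      proof -
        \<comment> \<open>Since \<open>Q = P + 2 * int k\<close>, the gcd of \<open>P\<close> with
          \<open>2 * int k\<close> is its gcd with the prime \<open>Q\<close>.\<close>
        have "coprime Q P"
          using pq PQ unfolding Qp
          by (intro prime_imp_coprime) (simp_all only: prime_nat_int_transfer not_False_eq_True)
        then show ?thesis
          unfolding Q_def by (simp add: coprime_iff_gcd_eq_1 gcd.commute)
      qed
      ultimately have "P dvd D" by (simp add: coprime_dvd_mult_right_iff)
      then have "p dvd (odd_double_fact k)\<^sup>2"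
        unfolding P_def D_def by (metis int_dvd_int_iff of_nat_power)
      then show False using assms(3) by contradiction
    qed
    with pq show "prime p \<and> prime (p + 2 * k)" by simp
  qed
  then show ?thesis
    unfolding E_def D_def F_def s_def Q_def P_def pm cong_0_iff .
qed

end
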